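(* Let $(\mathcal{T},d)$ be a countable metric space, $t_0\in\mathcal{T}$, and let $X_1,\dots,X_n$ be independent random elements of $L_\infty(\mathcal{T})$, $X_i=(X_i(t))_{t\in\mathcal{T}}$. Let $S\in\mathbb{N}$, and let the sets $\mathcal{G}_s$, the maps $t\mapsto w(t,s)$, and the quantities $H_s$, $d_j(s)$, $\gamma_n(S)$, $R_n(S)$, $\bar X_n$, $\bar\delta_n$ be as in the context. Assume that for each $t,\tilde t\in\mathcal{T}$ and all $\lambda>0$, $$\mathbb{E}\exp\Big[\lambda\Big|\sum_{i=1}^n(X_i(t)-X_i(\tilde t))\Big|\Big]\le2\exp\Big[\frac{n\lambda^2d^2(t,\tilde t)}{2}\Big].$$ Then $$\mathbb{E}\|\bar X_n-\bar X_n(t_0)\|_\infty\le\gamma_n(S)+\sqrt{2R_n^2(S)/n}+\mathbb{E}\|\bar\delta_n(\cdot,S)\|_\infty .$$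
   Context: $\{\mathcal{G}_s\}_{s\in\mathbb{N}}$ is a sequence of finite non-empty subsets of $\mathcal{T}$ and $\mathcal{G}_0=\{t_0\}$. For $s=0,\dots,S$, $t\mapsto w(t,s)\in\mathcal{G}_s$ are maps defined on $\mathcal{T}$. Define $$H_s:=\log(2|\mathcal{G}_s|),\quad s=1,\dots,S,\qquad d_j(s):=d(w(j,s),w(j,s-1)),\quad j\in\mathcal{G}_S,\ s=1,\dots,S,$$ $$\gamma_n(S):=\max_{j\in\mathcal{G}_S}\sum_{s=1}^Sd_j(s)\sqrt{2(H_s+s\log2)/n},\qquad R_n(S):=\max_{j\in\mathcal{G}_S}\sum_{s=1}^Sd_j(s),$$ $$\bar X_n(t):=\frac1n\sum_{i=1}^nX_i(t),\qquad\bar\delta_n(t,S):=\bar X_n(t)-\bar X_n(w(t,S)).$$ For a function $f$ on $\mathcal{T}$, $\|f\|_\infty:=\sup_{t\in\mathcal{T}}|f(t)|$; thus $\|\bar X_n-\bar X_n(t_0)\|_\infty=\sup_{t\in\mathcal{T}}|\bar X_n(t)-\bar X_n(t_0)|$.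
   Formalization: The formal theorem additionally assumes that for every t in T there is j in G_S with w(j,S) = w(t,S) (as holds if w(j,S) = j on G_S); without this the claimed inequality can fail. *)

theory Defs
  imports "HOL-Probability.Probability"
begin

(* Used for bounded functions only; the conditionally complete SUP on the reals is
   unspecified for unbounded ones. *)
definition sup_norm :: "('t \<Rightarrow> real) \<Rightarrow> real" where
  "sup_norm f = (SUP t. \<bar>f t\<bar>)"

definition entropy_H :: "(nat \<Rightarrow> 't set) \<Rightarrow> nat \<Rightarrow> real" where
  "entropy_H G s = ln (2 * real (card (G s)))"

(* A chain indexed by j in the finest set G S runs through w j S, ..., w j 0, so its starting
   point is w j S rather than j.  The sets G s and the maps w do not by themselves force every
   w t S to be the starting point of such a chain, which the decomposition
   X t - X t0 = (X t - X (w t S)) + (chain from w t S down to t0) needs;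
   this has to be required separately, and holds e.g. if w j S = j for all j in G S. *)
definition link_dist :: "('t::metric_space \<Rightarrow> nat \<Rightarrow> 't) \<Rightarrow> 't \<Rightarrow> nat \<Rightarrow> real" where
  "link_dist w j s = dist (w j s) (w j (s - 1))"

definition chain_gamma ::
  "nat \<Rightarrow> (nat \<Rightarrow> 't::metric_space set) \<Rightarrow> ('t \<Rightarrow> nat \<Rightarrow> 't) \<Rightarrow> nat \<Rightarrow> real" where
  "chain_gamma n G w S =
     Max ((\<lambda>j. \<Sum>s = 1..S. link_dist w j s *
                 sqrt (2 * (entropy_H G s + real s * ln 2) / real n)) ` G S)"

definition chain_R ::
  "(nat \<Rightarrow> 't::metric_space set) \<Rightarrow> ('t \<Rightarrow> nat \<Rightarrow> 't) \<Rightarrow> nat \<Rightarrow> real" where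
  "chain_R G w S = Max ((\<lambda>j. \<Sum>s = 1..S. link_dist w j s) ` G S)"

definition sample_mean :: "nat \<Rightarrow> (nat \<Rightarrow> 'w \<Rightarrow> 't \<Rightarrow> real) \<Rightarrow> 'w \<Rightarrow> 't \<Rightarrow> real" where
  "sample_mean n X \<omega> t = (1 / real n) * (\<Sum>i = 1..n. X i \<omega> t)"

definition chain_remainder ::
  "nat \<Rightarrow> (nat \<Rightarrow> 'w \<Rightarrow> 't \<Rightarrow> real) \<Rightarrow> ('t \<Rightarrow> nat \<Rightarrow> 't) \<Rightarrow> nat \<Rightarrow> 'w \<Rightarrow> 't \<Rightarrow> real" where
  "chain_remainder n X w S \<omega> t = sample_mean n X \<omega> t - sample_mean n X \<omega> (w t S)"

end

(* Fix u > 0 and give a link at level s the cost d_j(s) b_s with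
   b_s = sqrt (2 (H_s + s ln 2 + u^2) / n).  If every increment of the sample mean along the
   links is at most the cost of the link, then the chain from w j S down to t0 bounds the
   increment between its end points by gamma + R sqrt (2 / n) u.  By the sub-Gaussian tail a link
   at level s fails with probability at most 2 exp (- (H_s + s ln 2 + u^2)), so |G s| links at
   every level s fail with total probability at most exp (- u^2); integrating this tail over u
   costs a factor sqrt pi / 2 <= 1.

   However, chains through the same node y of G s may use different predecessors, and there may be
   far more than |G s| links at level s.  Hence only the links of cheapest paths to t0 are used:
   one per node, and following them never costs more than the given chain.  The choice of cheapest
   paths depends on u, which is harmless because the tail bound is applied for each u separately. *)
theory Submission imports Defs begin

definition cheapest :: "'j set \<Rightarrow> ('j \<Rightarrow> 'a) \<Rightarrow> ('j \<Rightarrow> real) \<Rightarrow> 'a \<Rightarrow> 'j" where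
  "cheapest J g c y = arg_min_on c {j \<in> J. g j = y}"

lemma cheapest_props:
  assumes "finite J" "j \<in> J"
  shows "cheapest J g c (g j) \<in> J" "g (cheapest J g c (g j)) = g j" "c (cheapest J g c (g j)) \<le> c j"
proof -
  let ?A = "{i \<in> J. g i = g j}"
  have fin: "finite ?A" and ne: "?A \<noteq> {}"
    using assms by auto
  show "cheapest J g c (g j) \<in> J" "g (cheapest J g c (g j)) = g j"
    using arg_min_if_finite(1)[OF fin ne, of c] by (auto simp: cheapest_def)
  show "c (cheapest J g c (g j)) \<le> c j"
    using arg_min_least[OF fin ne, of j c] assms by (auto simp: cheapest_def)
qed

definition path_cost :: "('a::metric_space \<Rightarrow> nat \<Rightarrow> 'a) \<Rightarrow> (nat \<Rightarrow> real) \<Rightarrow> nat \<Rightarrow> 'a \<Rightarrow> real" where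
  "path_cost w b s j = (\<Sum>r = 1..s. link_dist w j r * b r)"

definition pred_node ::
  "'a::metric_space set \<Rightarrow> ('a \<Rightarrow> nat \<Rightarrow> 'a) \<Rightarrow> (nat \<Rightarrow> real) \<Rightarrow> nat \<Rightarrow> 'a \<Rightarrow> 'a" where
  "pred_node J w b s y = w (cheapest J (\<lambda>j. w j s) (path_cost w b s) y) (s - 1)"

lemma abs_diff_le_path_cost:
  fixes f :: "'a::metric_space \<Rightarrow> real"
  assumes J: "finite J"
    and root: "\<And>j. j \<in> J \<Longrightarrow> w j 0 = t0"
    and links: "\<And>s j. 1 \<le> s \<Longrightarrow> s \<le> S \<Longrightarrow> j \<in> J \<Longrightarrow>
      \<bar>f (w j s) - f (pred_node J w b s (w j s))\<bar> \<le> dist (w j s) (pred_node J w b s (w j s)) * b s"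
    and "s \<le> S" "j \<in> J"
  shows "\<bar>f (w j s) - f t0\<bar> \<le> path_cost w b s j"
  using \<open>s \<le> S\<close> \<open>j \<in> J\<close>
proof (induction s arbitrary: j)
  case 0
  then show ?case by (simp add: root path_cost_def)
next
  case (Suc s)
  define i where "i = cheapest J (\<lambda>j. w j (Suc s)) (path_cost w b (Suc s)) (w j (Suc s))"
  have i: "i \<in> J" "w i (Suc s) = w j (Suc s)" "path_cost w b (Suc s) i \<le> path_cost w b (Suc s) j"
    using cheapest_props[OF J \<open>j \<in> J\<close>,
        where g = "\<lambda>j. w j (Suc s)" and c = "path_cost w b (Suc s)"]
    by (auto simp: i_def)
  have "pred_node J w b (Suc s) (w j (Suc s)) = w i s"
    by (simp add: pred_node_def i_def)
  then have "\<bar>f (w j (Suc s)) - f (w i s)\<bar> \<le> link_dist w i (Suc s) * b (Suc s)"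
    using links[of "Suc s" j] Suc.prems i by (simp add: link_dist_def)
  moreover have "\<bar>f (w i s) - f t0\<bar> \<le> path_cost w b s i"
    using Suc.IH[of i] Suc.prems i by simp
  moreover have "path_cost w b (Suc s) i = path_cost w b s i + link_dist w i (Suc s) * b (Suc s)"
    by (simp add: path_cost_def)
  ultimately show ?case
    using i(3) by linarith
qed

lemma subgaussian_tail:
  fixes Z :: "'w \<Rightarrow> real"
  assumes [measurable]: "Z \<in> borel_measurable M"
    and "\<sigma> > 0" "u > 0"
    and mgf: "\<And>l. l > 0 \<Longrightarrow>
      (\<integral>\<^sup>+ \<omega>. ennreal (exp (l * \<bar>Z \<omega>\<bar>)) \<partial>M) \<le> ennreal (2 * exp (l\<^sup>2 * \<sigma>\<^sup>2 / 2))"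
  shows "emeasure M {\<omega> \<in> space M. \<bar>Z \<omega>\<bar> > \<sigma> * sqrt (2 * u)} \<le> ennreal (2 * exp (- u))"
proof -
  define l where "l = sqrt (2 * u) / \<sigma>"
  have l: "l > 0" "l\<^sup>2 * \<sigma>\<^sup>2 = 2 * u" "l * (\<sigma> * sqrt (2 * u)) = 2 * u"
    using assms(2,3) by (auto simp: l_def power_divide)
  have "emeasure M {\<omega> \<in> space M. \<bar>Z \<omega>\<bar> > \<sigma> * sqrt (2 * u)}
      \<le> emeasure M {\<omega> \<in> space M. \<bar>Z \<omega>\<bar> \<ge> \<sigma> * sqrt (2 * u)}"
    by (intro emeasure_mono) auto
  also have "\<dots> \<le> ennreal (exp (- l * (\<sigma> * sqrt (2 * u)))) *
      (\<integral>\<^sup>+ \<omega>. ennreal (exp (l * \<bar>Z \<omega>\<bar>)) * indicator (space M) \<omega> \<partial>M)"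
    by (rule Chernoff_ineq_nn_integral_ge) (use l in auto)
  also have "\<dots> = ennreal (exp (- (2 * u))) * (\<integral>\<^sup>+ \<omega>. ennreal (exp (l * \<bar>Z \<omega>\<bar>)) \<partial>M)"
    using l(3) by (intro arg_cong2[where f = "(*)"] nn_integral_cong) (auto simp: mult.assoc)
  also have "\<dots> \<le> ennreal (exp (- (2 * u))) * ennreal (2 * exp (l\<^sup>2 * \<sigma>\<^sup>2 / 2))"
    by (intro mult_left_mono mgf l) auto
  also have "\<dots> = ennreal (2 * exp (- u))"
    by (simp add: l ennreal_mult[symmetric] exp_add[symmetric])
  finally show ?thesis .
qed

lemma nn_integral_exp_minus_square_le_1:
  "(\<integral>\<^sup>+ u. ennreal (exp (- u\<^sup>2)) * indicator {0<..} u \<partial>lborel) \<le> 1"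
proof -
  have "(\<integral>\<^sup>+ u. ennreal (exp (- u\<^sup>2)) * indicator {0<..} u \<partial>lborel)
      \<le> (\<integral>\<^sup>+ u. ennreal (indicator {0..} u *\<^sub>R exp (- u\<^sup>2)) \<partial>lborel)"
    by (intro nn_integral_mono) (auto split: split_indicator)
  also have "\<dots> = ennreal (sqrt pi / 2)"
    using nn_integral_eq_integral[of lborel "\<lambda>u::real. indicator {0..} u *\<^sub>R exp (- u\<^sup>2)"]
      gaussian_moment_0 by (auto simp: has_bochner_integral_iff)
  also have "sqrt pi \<le> sqrt 4"
    using pi_less_4 by (intro real_sqrt_le_mono) simp
  then have "ennreal (sqrt pi / 2) \<le> 1"
    by simp
  finally show ?thesis .
qed

lemma (in prob_space) expectation_le_of_gaussian_tail:
  fixes h :: "'a \<Rightarrow> real"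
  assumes [measurable]: "h \<in> borel_measurable M"
    and "c \<ge> 0" "K \<ge> 0"
    and tail: "\<And>u. u > 0 \<Longrightarrow> emeasure M {\<omega> \<in> space M. h \<omega> > c + K * u} \<le> ennreal (exp (- u\<^sup>2))"
  shows "(\<integral>\<^sup>+ \<omega>. ennreal (h \<omega>) \<partial>M) \<le> ennreal (c + K)"
proof (rule ennreal_le_epsilon)
  \<comment> \<open>Enlarging K to K + e allows division by the scale also when K = 0.\<close>
  fix e :: real assume "e > 0"
  define L where "L = K + e"
  have L: "L > 0" "K \<le> L"
    using \<open>K \<ge> 0\<close> \<open>e > 0\<close> by (auto simp: L_def)
  interpret pair_sigma_finite M lborel
    by (intro pair_sigma_finite.intro sigma_finite_lborel) unfold_locales
  have excess: "ennreal (h \<omega>) \<le> ennreal c + ennreal L *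
      (\<integral>\<^sup>+ u. indicator {0<..} u * indicator {u. c + L * u < h \<omega>} u \<partial>lborel)" for \<omega>
  proof -
    define v where "v = (h \<omega> - c) / L"
    have "(\<lambda>u. indicator {0<..} u * indicator {u. c + L * u < h \<omega>} u :: ennreal) = indicator {0<..<v}"
      using L by (auto simp: fun_eq_iff v_def field_simps split: split_indicator)
    then have "(\<integral>\<^sup>+ u. indicator {0<..} u * indicator {u. c + L * u < h \<omega>} u \<partial>lborel) = ennreal v"
      by (cases "0 \<le> v") (auto simp: ennreal_neg)
    moreover have "h \<omega> = c + L * v"
      using L by (simp add: v_def)
    then have "ennreal (h \<omega>) \<le> ennreal c + ennreal L * ennreal v"
      using L \<open>c \<ge> 0\<close> by (cases "0 \<le> v")
        (auto simp: ennreal_mult[symmetric] ennreal_plus[symmetric] ennreal_neg mult_nonneg_nonpos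
              simp del: ennreal_plus intro!: ennreal_leI)
    ultimately show ?thesis by simp
  qed
  have "(\<integral>\<^sup>+ \<omega>. ennreal (h \<omega>) \<partial>M) \<le> (\<integral>\<^sup>+ \<omega>. ennreal c + ennreal L *
      (\<integral>\<^sup>+ u. indicator {0<..} u * indicator {u. c + L * u < h \<omega>} u \<partial>lborel) \<partial>M)"
    by (intro nn_integral_mono excess)
  also have "\<dots> = ennreal c + ennreal L *
      (\<integral>\<^sup>+ \<omega>. (\<integral>\<^sup>+ u. indicator {0<..} u * indicator {u. c + L * u < h \<omega>} u \<partial>lborel) \<partial>M)"
    by (subst nn_integral_add) (auto simp: nn_integral_cmult emeasure_space_1)
  also have "(\<integral>\<^sup>+ \<omega>. (\<integral>\<^sup>+ u. indicator {0<..} u * indicator {u. c + L * u < h \<omega>} u \<partial>lborel) \<partial>M)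
      = (\<integral>\<^sup>+ u. (\<integral>\<^sup>+ \<omega>. indicator {0<..} u * indicator {u. c + L * u < h \<omega>} u \<partial>M) \<partial>lborel)"
    by (rule Fubini'[symmetric]) measurable
  also have "\<dots> = (\<integral>\<^sup>+ u. emeasure M {\<omega> \<in> space M. c + L * u < h \<omega>} * indicator {0<..} u \<partial>lborel)"
  proof (rule nn_integral_cong)
    fix u :: real
    have "(\<integral>\<^sup>+ \<omega>. indicator {0<..} u * indicator {u. c + L * u < h \<omega>} u \<partial>M) =
      (\<integral>\<^sup>+ \<omega>. indicator {0<..} u * indicator {\<omega> \<in> space M. c + L * u < h \<omega>} \<omega> \<partial>M)"
      by (intro nn_integral_cong) (auto split: split_indicator)
    then show "(\<integral>\<^sup>+ \<omega>. indicator {0<..} u * indicator {u. c + L * u < h \<omega>} u \<partial>M) =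
      emeasure M {\<omega> \<in> space M. c + L * u < h \<omega>} * indicator {0<..} u"
      by (simp add: nn_integral_cmult_indicator mult.commute)
  qed
  also have "\<dots> \<le> (\<integral>\<^sup>+ u. ennreal (exp (- u\<^sup>2)) * indicator {0<..} u \<partial>lborel)"
  proof (rule nn_integral_mono)
    fix u :: real
    show "emeasure M {\<omega> \<in> space M. c + L * u < h \<omega>} * indicator {0<..} u
        \<le> ennreal (exp (- u\<^sup>2)) * indicator {0<..} u"
    proof (cases "u > 0")
      case True
      have "K * u \<le> L * u"
        using True L by (intro mult_right_mono) auto
      then have "emeasure M {\<omega> \<in> space M. c + L * u < h \<omega>} \<le> emeasure M {\<omega> \<in> space M. c + K * u < h \<omega>}"
        by (intro emeasure_mono) auto
      also note tail[OF True]
      finally show ?thesis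
        using True by simp
    qed simp
  qed
  also note nn_integral_exp_minus_square_le_1
  finally have "(\<integral>\<^sup>+ \<omega>. ennreal (h \<omega>) \<partial>M) \<le> ennreal c + ennreal L * 1"
    by (simp add: mult_left_mono add_left_mono)
  then show "(\<integral>\<^sup>+ \<omega>. ennreal (h \<omega>) \<partial>M) \<le> ennreal (c + K) + ennreal e"
    using \<open>c \<ge> 0\<close> \<open>K \<ge> 0\<close> \<open>e > 0\<close> by (simp add: L_def add.assoc)
qed

lemma sum_half_powers_le_1: "(\<Sum>s = 1..S. (1 / 2) ^ s) \<le> (1 :: real)"
proof -
  have "(\<Sum>s = 1..S. (1 / 2) ^ s) = 1 - (1 / 2 :: real) ^ S"
    by (induction S) auto
  then show ?thesis by simp
qed

lemma path_cost_le_gamma_R: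
  assumes "finite (G S)" "j \<in> G S" "u \<ge> 0"
    and H: "\<And>s. entropy_H G s \<ge> 0"
    and b: "\<And>s. b s = sqrt (2 * (entropy_H G s + real s * ln 2 + u\<^sup>2) / real n)"
  shows "path_cost w b S j \<le> chain_gamma n G w S + sqrt (2 * (chain_R G w S)\<^sup>2 / real n) * u"
proof -
  define a where "a s = sqrt (2 * (entropy_H G s + real s * ln 2) / real n)" for s
  define k where "k = sqrt (2 / real n) * u"
  have "b s \<le> a s + k" for s
  proof -
    have "b s = sqrt (2 * (entropy_H G s + real s * ln 2) / real n + 2 / real n * u\<^sup>2)"
      by (simp add: b add_divide_distrib distrib_left)
    also have "\<dots> \<le> a s + sqrt (2 / real n * u\<^sup>2)"
      unfolding a_def using H[of s] by (intro sqrt_add_le_add_sqrt) auto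
    also have "sqrt (2 / real n * u\<^sup>2) = k"
      using \<open>u \<ge> 0\<close> by (simp only: real_sqrt_mult k_def real_sqrt_abs abs_of_nonneg)
    finally show ?thesis .
  qed
  then have "path_cost w b S j \<le> (\<Sum>s = 1..S. link_dist w j s * (a s + k))"
    unfolding path_cost_def by (intro sum_mono mult_left_mono) (auto simp: link_dist_def)
  also have "\<dots> = (\<Sum>s = 1..S. link_dist w j s * a s) + (\<Sum>s = 1..S. link_dist w j s) * k"
    by (simp add: distrib_left sum.distrib sum_distrib_right)
  also have "(\<Sum>s = 1..S. link_dist w j s * a s) \<le> chain_gamma n G w S"
    unfolding chain_gamma_def a_def using assms(1,2) by (intro Max_ge) auto
  also have R: "(\<Sum>s = 1..S. link_dist w j s) \<le> chain_R G w S"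
    unfolding chain_R_def using assms(1,2) by (intro Max_ge) auto
  then have "(\<Sum>s = 1..S. link_dist w j s) * k \<le> chain_R G w S * k"
    using \<open>u \<ge> 0\<close> by (intro mult_right_mono) (auto simp: k_def)
  also have "0 \<le> (\<Sum>s = 1..S. link_dist w j s)"
    by (intro sum_nonneg) (auto simp: link_dist_def)
  with R have "chain_R G w S \<ge> 0" by linarith
  then have "chain_R G w S * k = sqrt (2 * (chain_R G w S)\<^sup>2 / real n) * u"
    by (simp add: k_def real_sqrt_mult real_sqrt_divide)
  finally show ?thesis by simp
qed

lemma card_mult_exp_neg_entropy:
  assumes "card (G s) > 0"
  shows "real (card (G s)) * (2 * exp (- (entropy_H G s + real s * ln 2 + v))) = (1 / 2) ^ s * exp (- v)"
proof -
  have "exp (- (entropy_H G s + real s * ln 2 + v))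
      = inverse (exp (entropy_H G s)) * inverse (exp (real s * ln 2)) * exp (- v)"
    by (simp only: exp_minus[symmetric] exp_add[symmetric]) simp
  also have "exp (entropy_H G s) = 2 * real (card (G s))"
    using assms by (simp add: entropy_H_def)
  also have "exp (real s * ln 2) = (2 :: real) ^ s"
    by (simp add: exp_of_nat_mult)
  finally show ?thesis
    using assms by (simp add: field_simps)
qed

lemma abs_le_sup_norm:
  assumes "bounded (range f)"
  shows "\<bar>f t\<bar> \<le> sup_norm f"
proof -
  obtain B where "\<And>t. \<bar>f t\<bar> \<le> B"
    using assms by (auto simp: bounded_iff)
  then have "bdd_above (range (\<lambda>t. \<bar>f t\<bar>))"
    by (rule bdd_aboveI2)
  then show ?thesis
    unfolding sup_norm_def by (intro cSUP_upper) auto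
qed

lemma borel_measurable_sup_norm:
  fixes f :: "'w \<Rightarrow> 't \<Rightarrow> real"
  assumes "countable (UNIV :: 't set)"
    and "\<And>t. (\<lambda>\<omega>. f \<omega> t) \<in> borel_measurable M"
    and bd: "\<And>\<omega>. \<omega> \<in> space M \<Longrightarrow> bounded (range (f \<omega>))"
  shows "(\<lambda>\<omega>. sup_norm (f \<omega>)) \<in> borel_measurable M"
  unfolding sup_norm_def
proof (rule borel_measurable_cSUP)
  fix \<omega> assume "\<omega> \<in> space M"
  then obtain B where "\<And>t. \<bar>f \<omega> t\<bar> \<le> B"
    using bd by (force simp: bounded_iff)
  then show "bdd_above (range (\<lambda>t. \<bar>f \<omega> t\<bar>))"
    by (rule bdd_aboveI2)
qed (use assms in auto)

theorem theorem3p6p1: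
  fixes M :: "'w measure"
    and X :: "nat \<Rightarrow> 'w \<Rightarrow> 't::metric_space \<Rightarrow> real"
    and n S :: nat
    and t0 :: 't
    and G :: "nat \<Rightarrow> 't set"
    and w :: "'t \<Rightarrow> nat \<Rightarrow> 't"
  assumes "prob_space M"
    and "countable (UNIV :: 't set)"
    and "n \<ge> 1"
    and "prob_space.indep_vars M (\<lambda>_. PiM UNIV (\<lambda>_::'t. borel)) X {1..n}"
    and "\<And>i \<omega>. i \<in> {1..n} \<Longrightarrow> \<omega> \<in> space M \<Longrightarrow> bounded (range (X i \<omega>))"
    and "\<And>s. finite (G s)" and "\<And>s. G s \<noteq> {}" and "G 0 = {t0}"
    and "\<And>s t. s \<le> S \<Longrightarrow> w t s \<in> G s"
    and "\<And>t. \<exists>j\<in>G S. w j S = w t S"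
    and "\<And>t t' (l::real). l > 0 \<Longrightarrow>
           (\<integral>\<^sup>+ \<omega>. ennreal (exp (l * \<bar>\<Sum>i = 1..n. (X i \<omega> t - X i \<omega> t')\<bar>)) \<partial>M)
             \<le> ennreal (2 * exp (real n * l\<^sup>2 * (dist t t')\<^sup>2 / 2))"
  shows "(\<integral>\<^sup>+ \<omega>. ennreal (sup_norm (\<lambda>t. sample_mean n X \<omega> t - sample_mean n X \<omega> t0)) \<partial>M)
           \<le> ennreal (chain_gamma n G w S + sqrt (2 * (chain_R G w S)\<^sup>2 / real n))
             + (\<integral>\<^sup>+ \<omega>. ennreal (sup_norm (chain_remainder n X w S \<omega>)) \<partial>M)"
proof -
  interpret prob_space M by fact
  have fin: "finite (G s)" for s by fact
  have card_pos: "card (G s) > 0" for s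
    using assms(6,7) by (simp add: card_gt_0_iff)
  have H: "entropy_H G s \<ge> ln 2" for s
    unfolding entropy_H_def using card_pos[of s] by (intro ln_mono) auto
  have H0: "entropy_H G s \<ge> 0" for s
    using H[of s] ln_gt_zero[of "2::real"] by linarith
  have root: "w j 0 = t0" for j
    using assms(9)[of 0 j] assms(8) by simp
  define D where "D \<omega> t = sample_mean n X \<omega> t" for \<omega> t
  have [measurable]: "(\<lambda>\<omega>. X i \<omega> t) \<in> borel_measurable M" if "i \<in> {1..n}" for i t
  proof -
    have "X i \<in> measurable M (PiM UNIV (\<lambda>_. borel))"
      using assms(4) that by (simp add: indep_vars_def)
    from measurable_compose[OF this measurable_component_singleton] show ?thesis
      by simp
  qed
  have D[measurable]: "(\<lambda>\<omega>. D \<omega> t) \<in> borel_measurable M" for t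
    unfolding D_def sample_mean_def by (intro borel_measurable_times borel_measurable_sum) measurable
  have D_diff: "D \<omega> t - D \<omega> t' = (\<Sum>i = 1..n. (X i \<omega> t - X i \<omega> t')) / real n" for \<omega> t t'
    by (simp add: D_def sample_mean_def sum_subtractf diff_divide_distrib)

  have link_tail: "emeasure M {\<omega> \<in> space M. \<bar>D \<omega> t - D \<omega> t'\<bar> > dist t t' * sqrt (2 * v / real n)}
      \<le> ennreal (2 * exp (- v))" if "v > 0" for t t' v
  proof (cases "t = t'")
    case False
    define \<sigma> where "\<sigma> = dist t t' / sqrt (real n)"
    have "emeasure M {\<omega> \<in> space M. \<bar>D \<omega> t - D \<omega> t'\<bar> > \<sigma> * sqrt (2 * v)} \<le> ennreal (2 * exp (- v))"
    proof (rule subgaussian_tail)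
      fix l :: real assume "l > 0"
      have "(\<integral>\<^sup>+ \<omega>. ennreal (exp (l * \<bar>D \<omega> t - D \<omega> t'\<bar>)) \<partial>M)
          = (\<integral>\<^sup>+ \<omega>. ennreal (exp ((l / real n) * \<bar>\<Sum>i = 1..n. (X i \<omega> t - X i \<omega> t')\<bar>)) \<partial>M)"
        by (simp add: D_diff)
      also have "\<dots> \<le> ennreal (2 * exp (real n * (l / real n)\<^sup>2 * (dist t t')\<^sup>2 / 2))"
        using \<open>l > 0\<close> \<open>n \<ge> 1\<close> by (intro assms(11)) auto
      also have "real n * (l / real n)\<^sup>2 * (dist t t')\<^sup>2 = l\<^sup>2 * \<sigma>\<^sup>2"
        using \<open>n \<ge> 1\<close> by (simp add: \<sigma>_def power_divide field_simps power2_eq_square)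
      finally show "(\<integral>\<^sup>+ \<omega>. ennreal (exp (l * \<bar>D \<omega> t - D \<omega> t'\<bar>)) \<partial>M)
          \<le> ennreal (2 * exp (l\<^sup>2 * \<sigma>\<^sup>2 / 2))" .
    qed (use that False \<open>n \<ge> 1\<close> in \<open>auto simp: \<sigma>_def\<close>)
    moreover have "\<sigma> * sqrt (2 * v) = dist t t' * sqrt (2 * v / real n)"
      by (simp add: \<sigma>_def real_sqrt_divide)
    ultimately show ?thesis by simp
  qed simp

  define h where "h \<omega> = Max ((\<lambda>j. \<bar>D \<omega> (w j S) - D \<omega> t0\<bar>) ` G S)" for \<omega>
  have h_meas[measurable]: "h \<in> borel_measurable M"
    unfolding h_def using fin by measurable
  have h_ge: "\<bar>D \<omega> (w j S) - D \<omega> t0\<bar> \<le> h \<omega>" if "j \<in> G S" for \<omega> j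
    unfolding h_def using fin that by (intro Max_ge) auto

  let ?c = "chain_gamma n G w S" and ?K = "sqrt (2 * (chain_R G w S)\<^sup>2 / real n)"
  have c_nonneg: "?c \<ge> 0"
  proof -
    obtain j where "j \<in> G S" using assms(7) by blast
    have "0 \<le> (\<Sum>s = 1..S. link_dist w j s * sqrt (2 * (entropy_H G s + real s * ln 2) / real n))"
      using H0 by (intro sum_nonneg) (auto simp: link_dist_def)
    also have "\<dots> \<le> ?c"
      unfolding chain_gamma_def using fin \<open>j \<in> G S\<close> by (intro Max_ge) auto
    finally show ?thesis .
  qed

  have tail: "emeasure M {\<omega> \<in> space M. h \<omega> > ?c + ?K * u} \<le> ennreal (exp (- u\<^sup>2))" if "u > 0" for u
  proof -
    define v where "v s = entropy_H G s + real s * ln 2 + u\<^sup>2" for s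
    define b where "b s = sqrt (2 * v s / real n)" for s
    have v: "v s > 0" for s
      using H0[of s] that unfolding v_def by (intro add_nonneg_pos) auto
    define p where "p = pred_node (G S) w b"
    define B where "B s y = {\<omega> \<in> space M. \<bar>D \<omega> y - D \<omega> (p s y)\<bar> > dist y (p s y) * b s}" for s y
    have B_sets: "B s y \<in> sets M" for s y
      unfolding B_def by measurable
    have "{\<omega> \<in> space M. h \<omega> > ?c + ?K * u} \<subseteq> (\<Union>s\<in>{1..S}. \<Union>y\<in>G s. B s y)"
    proof (rule subsetI, rule ccontr)
      fix \<omega> assume \<omega>: "\<omega> \<in> {\<omega> \<in> space M. h \<omega> > ?c + ?K * u}"
        and "\<omega> \<notin> (\<Union>s\<in>{1..S}. \<Union>y\<in>G s. B s y)"
      then have good: "\<bar>D \<omega> y - D \<omega> (p s y)\<bar> \<le> dist y (p s y) * b s"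
        if "1 \<le> s" "s \<le> S" "y \<in> G s" for s y
        using that by (force simp: B_def)
      have "\<bar>D \<omega> (w j S) - D \<omega> t0\<bar> \<le> ?c + ?K * u" if "j \<in> G S" for j
      proof -
        have "\<bar>D \<omega> (w j S) - D \<omega> t0\<bar> \<le> path_cost w b S j"
          using that good assms(9)
          by (intro abs_diff_le_path_cost[where J = "G S" and S = S])
             (auto simp: fin root p_def)
        also have "\<dots> \<le> ?c + ?K * u"
          using that fin H0 \<open>u > 0\<close>
          by (intro path_cost_le_gamma_R) (auto simp: b_def v_def)
        finally show ?thesis .
      qed
      then have "h \<omega> \<le> ?c + ?K * u"
        unfolding h_def using fin assms(7) by (subst Max_le_iff) auto
      with \<omega> show False by simp
    qed
    then have "emeasure M {\<omega> \<in> space M. h \<omega> > ?c + ?K * u}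
        \<le> emeasure M (\<Union>s\<in>{1..S}. \<Union>y\<in>G s. B s y)"
      by (rule emeasure_mono) (intro sets.finite_UN fin B_sets finite_atLeastAtMost)
    also have "\<dots> \<le> (\<Sum>s = 1..S. emeasure M (\<Union>y\<in>G s. B s y))"
      using fin B_sets by (intro emeasure_subadditive_finite) auto
    also have "\<dots> \<le> (\<Sum>s = 1..S. \<Sum>y\<in>G s. emeasure M (B s y))"
      using fin B_sets by (intro sum_mono emeasure_subadditive_finite) auto
    also have "\<dots> \<le> (\<Sum>s = 1..S. \<Sum>y\<in>G s. ennreal (2 * exp (- v s)))"
      unfolding B_def b_def by (intro sum_mono link_tail v)
    also have "\<dots> = (\<Sum>s = 1..S. ennreal ((1 / 2) ^ s * exp (- u\<^sup>2)))"
    proof (rule sum.cong)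
      fix s
      have "(\<Sum>y\<in>G s. ennreal (2 * exp (- v s))) = ennreal (real (card (G s)) * (2 * exp (- v s)))"
        by (subst sum_ennreal) simp_all
      also have "\<dots> = ennreal ((1 / 2) ^ s * exp (- u\<^sup>2))"
        unfolding v_def by (subst card_mult_exp_neg_entropy[OF card_pos]) simp
      finally show "(\<Sum>y\<in>G s. ennreal (2 * exp (- v s))) = ennreal ((1 / 2) ^ s * exp (- u\<^sup>2))" .
    qed simp
    also have "\<dots> = ennreal ((\<Sum>s = 1..S. (1 / 2) ^ s) * exp (- u\<^sup>2))"
      by (simp add: sum_ennreal sum_distrib_right)
    also have "\<dots> \<le> ennreal (1 * exp (- u\<^sup>2))"
      by (intro ennreal_leI mult_right_mono sum_half_powers_le_1) simp
    finally show ?thesis by simp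
  qed

  have bounded_D: "bounded (range (D \<omega>))" if "\<omega> \<in> space M" for \<omega>
  proof -
    have "\<exists>B. \<forall>t. \<bar>X i \<omega> t\<bar> \<le> B" if "i \<in> {1..n}" for i
      using assms(5)[OF that \<open>\<omega> \<in> space M\<close>] by (auto simp: bounded_iff)
    then obtain B where B: "\<And>i t. i \<in> {1..n} \<Longrightarrow> \<bar>X i \<omega> t\<bar> \<le> B i"
      by metis
    have "\<bar>D \<omega> t\<bar> \<le> (1 / real n) * (\<Sum>i = 1..n. B i)" for t
    proof -
      have "\<bar>\<Sum>i = 1..n. X i \<omega> t\<bar> \<le> (\<Sum>i = 1..n. B i)"
        by (intro order.trans[OF sum_abs] sum_mono B)
      then show ?thesis
        unfolding D_def sample_mean_def abs_mult by (simp add: divide_right_mono)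
    qed
    then show ?thesis
      by (auto simp: bounded_iff)
  qed
  have bounded_rem: "bounded (range (chain_remainder n X w S \<omega>))" if "\<omega> \<in> space M" for \<omega>
  proof -
    obtain B where B: "\<And>t. \<bar>D \<omega> t\<bar> \<le> B"
      using bounded_D[OF \<open>\<omega> \<in> space M\<close>] by (auto simp: bounded_iff)
    have "\<bar>chain_remainder n X w S \<omega> t\<bar> \<le> B + B" for t
      using B[of t] B[of "w t S"] unfolding chain_remainder_def D_def by linarith
    then show ?thesis
      by (auto simp: bounded_iff)
  qed
  have rem_meas: "(\<lambda>\<omega>. sup_norm (chain_remainder n X w S \<omega>)) \<in> borel_measurable M"
    using D bounded_rem unfolding D_def
    by (intro borel_measurable_sup_norm assms(2)) (auto simp: chain_remainder_def)

  have "ennreal (sup_norm (\<lambda>t. sample_mean n X \<omega> t - sample_mean n X \<omega> t0))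
      \<le> ennreal (h \<omega>) + ennreal (sup_norm (chain_remainder n X w S \<omega>))" if "\<omega> \<in> space M" for \<omega>
  proof -
    have "sup_norm (\<lambda>t. sample_mean n X \<omega> t - sample_mean n X \<omega> t0)
        \<le> h \<omega> + sup_norm (chain_remainder n X w S \<omega>)"
      unfolding sup_norm_def[of "\<lambda>t. _ t - _"]
    proof (rule cSUP_least)
      fix t
      obtain j where "j \<in> G S" "w j S = w t S"
        using assms(10) by blast
      then have "\<bar>D \<omega> (w t S) - D \<omega> t0\<bar> \<le> h \<omega>"
        using h_ge[of j \<omega>] by simp
      moreover have "\<bar>D \<omega> t - D \<omega> (w t S)\<bar> \<le> sup_norm (chain_remainder n X w S \<omega>)"
        using abs_le_sup_norm[OF bounded_rem[OF that], of t] by (simp add: chain_remainder_def D_def)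
      ultimately show "\<bar>sample_mean n X \<omega> t - sample_mean n X \<omega> t0\<bar>
          \<le> h \<omega> + sup_norm (chain_remainder n X w S \<omega>)"
        unfolding D_def by linarith
    qed simp
    moreover have "h \<omega> \<ge> 0"
    proof -
      obtain j where "j \<in> G S" using assms(7) by blast
      then show ?thesis using h_ge[of j \<omega>] by linarith
    qed
    moreover have "sup_norm (chain_remainder n X w S \<omega>) \<ge> 0"
      using abs_le_sup_norm[OF bounded_rem[OF that], of t0] by linarith
    ultimately show ?thesis
      by (simp add: ennreal_plus[symmetric] ennreal_leI del: ennreal_plus)
  qed
  then have "(\<integral>\<^sup>+ \<omega>. ennreal (sup_norm (\<lambda>t. sample_mean n X \<omega> t - sample_mean n X \<omega> t0)) \<partial>M)
      \<le> (\<integral>\<^sup>+ \<omega>. ennreal (h \<omega>) + ennreal (sup_norm (chain_remainder n X w S \<omega>)) \<partial>M)"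
    by (rule nn_integral_mono)
  also have "\<dots> = (\<integral>\<^sup>+ \<omega>. ennreal (h \<omega>) \<partial>M)
      + (\<integral>\<^sup>+ \<omega>. ennreal (sup_norm (chain_remainder n X w S \<omega>)) \<partial>M)"
    using rem_meas by (intro nn_integral_add) auto
  also have "(\<integral>\<^sup>+ \<omega>. ennreal (h \<omega>) \<partial>M) \<le> ennreal (?c + ?K)"
    by (rule expectation_le_of_gaussian_tail) (use c_nonneg tail in auto)
  finally show ?thesis
    by (simp add: add_right_mono)
qed

end
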